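(* Let $0<\varepsilon<1/2$ and consider the sequential hypothesis testing problem of deciding between $H_0: p=1/2-\varepsilon$ and $H_1: p=1/2+\varepsilon$. Let $c\ge 0$ be an integer and let $\mathcal{P}_c$ be the linear policy with threshold $c$, with profile $(\delta_c^+,\delta_c^-,H_c^+,H_c^-)$. Let $\mathcal{P}$ be any other policy, with profile $(\delta^+,\delta^-,H^+,H^-)$. If $\delta^+ + \delta^- < \delta_c^+ + \delta_c^-$, then $H^+ + H^- > H_c^+ + H_c^-$.
   Context: A coin with unknown heads probability $p\in\{1/2-\varepsilon,\,1/2+\varepsilon\}$ is tossed independently and repeatedly. The state $(h,t)\in\mathbb{Z}_{\ge 0}^2$ records the numbers of heads $h$ and tails $t$ observed so far, starting at $(0,0)$; each toss increases $h$ by 1 with probability $p$ and increases $t$ by 1 with probability $1-p$. A policy is a coloring of $\mathbb{Z}_{\ge 0}^2$ with the colors white, blue and red: at a white cell the policy tosses again; at a blue cell it stops and predicts $1/2+\varepsilon$; at a red cell it stops and predicts $1/2-\varepsilon$. Only policies with finite expected number of tosses (under both values of $p$) are considered. The profile of a policy $\mathcal{P}$ consists of $\delta^+=\Pr_{1/2+\varepsilon}[\mathcal{P}\text{ predicts }1/2-\varepsilon]$, $\delta^-=\Pr_{1/2-\varepsilon}[\mathcal{P}\text{ predicts }1/2+\varepsilon]$, $H^+=\mathbb{E}_{1/2+\varepsilon}[\#\text{ tosses by }\mathcal{P}]$, $H^-=\mathbb{E}_{1/2-\varepsilon}[\#\text{ tosses by }\mathcal{P}]$, where the subscript is the true value of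 $p$. For an integer $c\ge 0$, the linear policy $\mathcal{P}_c$ stops the first time $|h-t|=c$, and predicts $1/2+\varepsilon$ if $h>t$ at that time and $1/2-\varepsilon$ otherwise. (For $c=0$ it stops immediately at $(0,0)$ without tossing.) *)

theory Defs
  imports "HOL-Probability.Probability"
begin

datatype colour = White | Blue | Red

type_synonym policy = "nat \<times> nat \<Rightarrow> colour"

text \<open>Infinitely many independent tosses of a coin with heads probability \<open>p\<close>;
  \<open>True\<close> means heads. The term \<open>bernoulli_pmf p\<close> has the intended meaning for
  \<open>p\<close> in \<open>[0, 1]\<close> only.\<close>

definition coin_space :: "real \<Rightarrow> bool stream measure" where
  "coin_space p = stream_space (measure_pmf (bernoulli_pmf p))"

definition state :: "bool stream \<Rightarrow> nat \<Rightarrow> nat \<times> nat" where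
  "state \<omega> n = (card {i. i < n \<and> \<omega> !! i}, card {i. i < n \<and> \<not> \<omega> !! i})"

text \<open>The number of tosses is infinite on the runs on which the policy never stops;
  on such runs the policy predicts nothing.\<close>

definition tosses :: "policy \<Rightarrow> bool stream \<Rightarrow> enat" where
  "tosses P \<omega> = (if \<exists>n. P (state \<omega> n) \<noteq> White
                 then enat (LEAST n. P (state \<omega> n) \<noteq> White) else \<infinity>)"

definition stops_at :: "policy \<Rightarrow> colour \<Rightarrow> bool stream \<Rightarrow> bool" where
  "stops_at P col \<omega> \<longleftrightarrow> (\<exists>n. tosses P \<omega> = enat n \<and> P (state \<omega> n) = col)"

definition prob_stops_at :: "real \<Rightarrow> policy \<Rightarrow> colour \<Rightarrow> real" where
  "prob_stops_at p P col =
     measure (coin_space p) {\<omega> \<in> space (coin_space p). stops_at P col \<omega>}"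

definition expected_tosses :: "real \<Rightarrow> policy \<Rightarrow> ennreal" where
  "expected_tosses p P = (\<integral>\<^sup>+ \<omega>. ennreal_of_enat (tosses P \<omega>) \<partial>coin_space p)"

text \<open>Blue is the prediction \<open>1/2 + \<epsilon>\<close> and red the prediction \<open>1/2 - \<epsilon>\<close>, so the error
  is to stop at a red cell when \<open>p = 1/2 + \<epsilon>\<close> and at a blue cell when \<open>p = 1/2 - \<epsilon>\<close>.\<close>

definition delta_plus :: "real \<Rightarrow> policy \<Rightarrow> real" where
  "delta_plus \<epsilon> P = prob_stops_at (1/2 + \<epsilon>) P Red"

definition delta_minus :: "real \<Rightarrow> policy \<Rightarrow> real" where
  "delta_minus \<epsilon> P = prob_stops_at (1/2 - \<epsilon>) P Blue"

definition H_plus :: "real \<Rightarrow> policy \<Rightarrow> ennreal" where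
  "H_plus \<epsilon> P = expected_tosses (1/2 + \<epsilon>) P"

definition H_minus :: "real \<Rightarrow> policy \<Rightarrow> ennreal" where
  "H_minus \<epsilon> P = expected_tosses (1/2 - \<epsilon>) P"

definition admissible :: "real \<Rightarrow> policy \<Rightarrow> bool" where
  "admissible \<epsilon> P \<longleftrightarrow> H_plus \<epsilon> P < \<infinity> \<and> H_minus \<epsilon> P < \<infinity>"

text \<open>The cells with \<open>\<bar>h - t\<bar> > c\<close> are never reached before stopping, so their colour
  is immaterial.\<close>

definition linear_policy :: "nat \<Rightarrow> policy" where
  "linear_policy c = (\<lambda>(h, t).
     if \<bar>int h - int t\<bar> = int c then (if h > t then Blue else Red) else White)"

end

theory Submission imports Defs
begin

text \<open>
  Write \<open>q = 1/2 + \<epsilon>\<close>, \<open>r = 1/2 - \<epsilon>\<close>, and let \<open>D = h - t\<close> be the lead of heads at the stopping time.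
  By Wald's identity \<open>(q - r) * (H\<^sup>+ + H\<^sup>-)\<close> is the difference of the expectations of \<open>D\<close> under the
  two hypotheses. Since \<open>D\<close> is, up to the factor \<open>ln (q / r)\<close>, the log-likelihood ratio, this difference
  is a sum over the stopping cells of \<open>(1 - 2 * e) * ln ((1 - e) / e)\<close>, where \<open>e\<close> is the posterior
  error probability at the cell. This function of \<open>e\<close> is convex and decreasing on \<open>(0, 1/2]\<close>, and under
  the linear policy \<open>e\<close> is constant, so its tangent line at that constant bounds \<open>H\<^sup>+ + H\<^sup>-\<close> from
  below by an affine decreasing function of \<open>\<delta>\<^sup>+ + \<delta>\<^sup>-\<close>. To avoid optional stopping, everything is
  done for the policy truncated after \<open>n\<close> tosses.
\<close>

section \<open>Truncated policies as finite recursions\<close>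

definition toss :: "bool \<Rightarrow> nat \<times> nat" where
  "toss b = (if b then (1, 0) else (0, 1))"

text \<open>Recursion on the first toss with a free start cell \<open>s\<close> matches the
  head-tail decomposition of the stream space.\<close>

primrec stopped :: "policy \<Rightarrow> nat \<Rightarrow> nat \<times> nat \<Rightarrow> bool stream \<Rightarrow> nat \<times> nat" where
  "stopped P 0 s \<omega> = s"
| "stopped P (Suc n) s \<omega> =
     (if P s = White then stopped P n (s + toss (shd \<omega>)) (stl \<omega>) else s)"

text \<open>The expectation of \<open>F\<close> at the cell where the truncated policy ends. Being a
  finite recursion, it makes sense for signed \<open>F\<close> without integrability conditions;
  \<open>nn_integral_stopped\<close> links it to \<open>coin_space\<close> for nonnegative
  \<open>F\<close>.\<close>

primrec stopped_mean ::
    "real \<Rightarrow> policy \<Rightarrow> (nat \<times> nat \<Rightarrow> real) \<Rightarrow> nat \<Rightarrow> nat \<times> nat \<Rightarrow> real" where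
  "stopped_mean p P F 0 s = F s"
| "stopped_mean p P F (Suc n) s =
     (if P s = White
      then p * stopped_mean p P F n (s + toss True)
         + (1 - p) * stopped_mean p P F n (s + toss False)
      else F s)"

abbreviation colour_prob :: "real \<Rightarrow> policy \<Rightarrow> colour \<Rightarrow> nat \<Rightarrow> real" where
  "colour_prob p P col n \<equiv> stopped_mean p P (\<lambda>s. of_bool (P s = col)) n (0, 0)"

lemma stopped_mean_nonneg:
  assumes "0 \<le> p" "p \<le> 1" "\<And>s. 0 \<le> F s"
  shows "0 \<le> stopped_mean p P F n s"
  using assms by (induction n arbitrary: s) auto

lemma stopped_mean_const: "stopped_mean p P (\<lambda>_. a) n s = a"
  by (induction n arbitrary: s) (auto simp: algebra_simps)

lemma stopped_mean_add:
  "stopped_mean p P (\<lambda>s. F s + G s) n s = stopped_mean p P F n s + stopped_mean p P G n s"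
  by (induction n arbitrary: s) (auto simp: algebra_simps)

lemma stopped_mean_cmult:
  "stopped_mean p P (\<lambda>s. a * F s) n s = a * stopped_mean p P F n s"
  by (induction n arbitrary: s) (auto simp: algebra_simps)

lemma stopped_mean_diff:
  "stopped_mean p P (\<lambda>s. F s - G s) n s = stopped_mean p P F n s - stopped_mean p P G n s"
  using stopped_mean_add[of p P F "\<lambda>s. - 1 * G s" n s] stopped_mean_cmult[of p P "- 1" G n s]
  by simp

lemma stopped_mean_minus:
  "stopped_mean p P (\<lambda>s. - F s) n s = - stopped_mean p P F n s"
  using stopped_mean_cmult[of p P "-1" F n s] by simp

lemmas stopped_mean_linear =
  stopped_mean_add stopped_mean_diff stopped_mean_cmult stopped_mean_minus stopped_mean_const

definition lead :: "nat \<times> nat \<Rightarrow> real" where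
  "lead s = real (fst s) - real (snd s)"

text \<open>Wald's identity under truncation: a toss has mean drift \<open>2 * p - 1\<close>, and
  toss number \<open>k + 1\<close> takes place exactly when the cell after \<open>k\<close> tosses
  is still white.\<close>

lemma stopped_mean_lead:
  "stopped_mean p P lead n s =
     lead s + (2 * p - 1) * (\<Sum>k<n. stopped_mean p P (\<lambda>s. of_bool (P s = White)) k s)"
proof (induction n arbitrary: s)
  case (Suc n)
  let ?W = "\<lambda>k s. stopped_mean p P (\<lambda>s. of_bool (P s = White)) k s"
  show ?case
  proof (cases "P s = White")
    case True
    have sum: "(\<Sum>k<Suc n. ?W k s) =
        1 + p * (\<Sum>k<n. ?W k (s + toss True)) + (1 - p) * (\<Sum>k<n. ?W k (s + toss False))"
      using True by (simp only: sum.lessThan_Suc_shift) (simp add: sum.distrib sum_distrib_left)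
    have lead: "lead (s + toss True) = lead s + 1" "lead (s + toss False) = lead s - 1"
      by (simp_all add: lead_def toss_def)
    have "stopped_mean p P lead (Suc n) s =
        p * stopped_mean p P lead n (s + toss True)
        + (1 - p) * stopped_mean p P lead n (s + toss False)"
      using True by simp
    then show ?thesis unfolding sum Suc.IH lead by (simp add: algebra_simps)
  next
    case False
    then have "?W k s = 0" for k by (cases k) auto
    then show ?thesis using False by simp
  qed
qed simp

text \<open>A run ending in \<open>(h, t)\<close> has probability \<open>q ^ h * r ^ t\<close> under one hypothesis and
  \<open>r ^ h * q ^ t\<close> under the other, so an inequality between the two expectations may be checked
  cell by cell.\<close>

lemma mixture_nonneg:
  fixes q r :: real
  assumes qr: "q + r = 1"
    and inv: "\<And>s b. s \<in> S \<Longrightarrow> P s = White \<Longrightarrow> s + toss b \<in> S"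
    and cell: "\<And>h t. (h, t) \<in> S \<Longrightarrow> 0 \<le> q ^ h * r ^ t * F (h, t) + r ^ h * q ^ t * G (h, t)"
    and "(h, t) \<in> S"
  shows "0 \<le> q ^ h * r ^ t * stopped_mean q P F n (h, t)
           + r ^ h * q ^ t * stopped_mean r P G n (h, t)"
  using \<open>(h, t) \<in> S\<close>
proof (induction n arbitrary: h t)
  case (Suc n)
  have r: "1 - q = r" "1 - r = q" using qr by auto
  show ?case
  proof (cases "P (h, t) = White")
    case True
    have "(h + 1, t) \<in> S" "(h, t + 1) \<in> S"
      using inv[OF Suc.prems True, of True] inv[OF Suc.prems True, of False]
      by (auto simp: toss_def)
    \<comment> \<open>The likelihood weights absorb the toss probabilities: a head multiplies them
      by \<open>q\<close> and \<open>r\<close>, a tail by \<open>r\<close> and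
      \<open>q\<close>.\<close>
    from Suc.IH[OF this(1)] Suc.IH[OF this(2)] show ?thesis
      using True by (simp add: r toss_def algebra_simps)
  qed (use cell[OF Suc.prems] in simp)
qed (use cell in simp)

text \<open>At the origin both weights are 1. The invariant set \<open>S\<close> serves cell
  inequalities that hold only where the policy can lead, such as the strip of a linear
  policy.\<close>

lemma mixture_nonneg_0:
  fixes q r :: real
  assumes "q + r = 1"
    and "\<And>s b. s \<in> S \<Longrightarrow> P s = White \<Longrightarrow> s + toss b \<in> S"
    and "\<And>h t. (h, t) \<in> S \<Longrightarrow> 0 \<le> q ^ h * r ^ t * F (h, t) + r ^ h * q ^ t * G (h, t)"
    and "(0, 0) \<in> S"
  shows "0 \<le> stopped_mean q P F n (0, 0) + stopped_mean r P G n (0, 0)"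
  using mixture_nonneg[OF assms] by simp

section \<open>The distribution of the stopped process\<close>

lemma state_0: "state \<omega> 0 = (0, 0)"
  by (simp add: state_def)

lemma state_Suc: "state \<omega> (Suc n) = toss (shd \<omega>) + state (stl \<omega>) n"
proof -
  have *: "{i. i < Suc n \<and> Q (\<omega> !! i)} =
      (if Q (shd \<omega>) then {0} else {}) \<union> Suc ` {i. i < n \<and> Q (stl \<omega> !! i)}" for Q
    by (auto simp: image_iff less_Suc_eq_0_disj split: if_splits)
  have "card {i. i < Suc n \<and> Q (\<omega> !! i)} =
      of_bool (Q (shd \<omega>)) + card {i. i < n \<and> Q (stl \<omega> !! i)}" for Q
    unfolding * by (subst card_Un_disjoint) (auto simp: card_image)
  from this[of "\<lambda>b. b"] this[of Not] show ?thesis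
    by (simp add: state_def toss_def)
qed

text \<open>Here \<open>m\<close> is the minimum of the stopping time and \<open>n\<close>,
  described by colours alone so that the induction can move the start cell.\<close>

lemma stopped_eq_state:
  assumes "\<forall>k<m. P (s + state \<omega> k) = White" "m \<le> n" "m = n \<or> P (s + state \<omega> m) \<noteq> White"
  shows "stopped P n s \<omega> = s + state \<omega> m"
  using assms
proof (induction n arbitrary: m s \<omega>)
  case 0
  then show ?case by (simp add: state_0 zero_prod_def[symmetric])
next
  case (Suc n)
  show ?case
  proof (cases m)
    case 0
    then show ?thesis using Suc.prems by (auto simp: state_0 zero_prod_def[symmetric])
  next
    case (Suc m')
    have "P s = White" using Suc.prems(1) Suc
      by (auto simp: state_0 zero_prod_def[symmetric] dest!: spec[of _ 0])
    moreover have "stopped P n (s + toss (shd \<omega>)) (stl \<omega>)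
        = s + toss (shd \<omega>) + state (stl \<omega>) m'"
      using Suc.prems Suc by (intro Suc.IH) (auto simp: state_Suc add.assoc dest: spec[of _ "Suc _"])
    ultimately show ?thesis using Suc by (simp add: state_Suc add.assoc)
  qed
qed

lemma tosses_eq_enat_iff:
  "tosses P \<omega> = enat m \<longleftrightarrow> P (state \<omega> m) \<noteq> White \<and> (\<forall>k<m. P (state \<omega> k) = White)"
proof
  assume "tosses P \<omega> = enat m"
  then have "\<exists>n. P (state \<omega> n) \<noteq> White" "m = (LEAST n. P (state \<omega> n) \<noteq> White)"
    by (auto simp: tosses_def split: if_splits)
  then show "P (state \<omega> m) \<noteq> White \<and> (\<forall>k<m. P (state \<omega> k) = White)"
    by (metis (mono_tags, lifting) LeastI_ex not_less_Least)
next
  assume *: "P (state \<omega> m) \<noteq> White \<and> (\<forall>k<m. P (state \<omega> k) = White)"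
  then have "(LEAST n. P (state \<omega> n) \<noteq> White) = m"
    by (intro Least_equality) (auto simp: not_less[symmetric])
  with * show "tosses P \<omega> = enat m" by (auto simp: tosses_def)
qed

lemma stopped_tosses:
  assumes "tosses P \<omega> = enat m"
  shows "stopped P n (0, 0) \<omega> = state \<omega> (min m n)"
  using stopped_eq_state[of "min m n" P "(0, 0)" \<omega> n] assms
  by (auto simp: tosses_eq_enat_iff min_def zero_prod_def[symmetric])

lemma stopped_tosses_infinity:
  assumes "tosses P \<omega> = \<infinity>"
  shows "stopped P n (0, 0) \<omega> = state \<omega> n" "P (state \<omega> n) = White"
proof -
  have *: "P (state \<omega> k) = White" for k
    using assms by (auto simp: tosses_def split: if_splits)
  then show "P (state \<omega> n) = White" .
  show "stopped P n (0, 0) \<omega> = state \<omega> n"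
    using stopped_eq_state[of n P "(0, 0)" \<omega> n] * by (auto simp: zero_prod_def[symmetric])
qed

text \<open>The stopped process freezes at its first non-white cell, so tail events of the number of
  tosses become colour events.\<close>

lemma less_tosses_iff: "enat n < tosses P \<omega> \<longleftrightarrow> P (stopped P n (0, 0) \<omega>) = White"
proof (cases "tosses P \<omega>")
  case (enat m)
  then have "P (state \<omega> m) \<noteq> White" "\<forall>k<m. P (state \<omega> k) = White"
    by (auto simp: tosses_eq_enat_iff)
  then show ?thesis
    using stopped_tosses[OF enat, of n] by (cases "m \<le> n") (auto simp: enat min_def)
qed (use stopped_tosses_infinity in auto)

lemma stopped_colour_iff:
  assumes "col \<noteq> White"
  shows "P (stopped P n (0, 0) \<omega>) = col \<longleftrightarrow>
    (\<exists>m\<le>n. tosses P \<omega> = enat m \<and> P (state \<omega> m) = col)"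
proof (cases "tosses P \<omega>")
  case (enat m)
  then have "P (state \<omega> m) \<noteq> White" "\<forall>k<m. P (state \<omega> k) = White"
    by (auto simp: tosses_eq_enat_iff)
  then show ?thesis
    using stopped_tosses[OF enat, of n] assms by (cases "m \<le> n") (auto simp: enat min_def)
qed (use stopped_tosses_infinity assms in auto)

lemma stops_at_iff:
  assumes "col \<noteq> White"
  shows "stops_at P col \<omega> \<longleftrightarrow> (\<exists>n. P (stopped P n (0, 0) \<omega>) = col)"
  unfolding stops_at_def stopped_colour_iff[OF assms] by auto

lemma space_coin_space [simp]: "space (coin_space p) = UNIV"
  by (simp add: coin_space_def space_stream_space)

lemma measurable_stopped:
  "stopped P n s \<in> measurable (coin_space p) (count_space UNIV)"
proof (induction n arbitrary: s)
  case 0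
  have "stopped P 0 s = (\<lambda>\<omega>. s)" by auto
  then show ?case by simp
next
  case (Suc n)
  have stl: "stl \<in> measurable (coin_space p) (coin_space p)"
    unfolding coin_space_def by measurable
  have shd: "shd \<in> measurable (coin_space p) (count_space UNIV)"
    unfolding coin_space_def
    by (rule measurable_compose[OF measurable_shd]) simp
  have *: "(\<lambda>\<omega>. stopped P n (s + toss b) (stl \<omega>)) \<in> measurable (coin_space p) (count_space UNIV)"
    for b by (rule measurable_compose[OF stl Suc.IH])
  have "(\<lambda>\<omega>. stopped P n (s + toss (shd \<omega>)) (stl \<omega>)) \<in>
      measurable (coin_space p) (count_space UNIV)"
    by (rule measurable_compose_countable[OF * shd])
  moreover have "stopped P (Suc n) s =
      (if P s = White then \<lambda>\<omega>. stopped P n (s + toss (shd \<omega>)) (stl \<omega>) else (\<lambda>\<omega>. s))"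
    by auto
  ultimately show ?case by simp
qed

interpretation coin: prob_space "coin_space p" for p
  unfolding coin_space_def by (rule prob_space.prob_space_stream_space) (rule prob_space_measure_pmf)

lemma nn_integral_stopped:
  assumes p: "0 \<le> p" "p \<le> 1" and F: "\<And>s. 0 \<le> F s"
  shows "(\<integral>\<^sup>+ \<omega>. ennreal (F (stopped P n s \<omega>)) \<partial>coin_space p) = ennreal (stopped_mean p P F n s)"
proof (induction n arbitrary: s)
  case 0
  show ?case using coin.emeasure_space_1[of p] by simp
next
  case (Suc n)
  have m: "(\<lambda>\<omega>. ennreal (F (stopped P (Suc n) s \<omega>))) \<in> borel_measurable (coin_space p)"
    by (rule measurable_compose[OF measurable_stopped]) simp
  show ?case
  proof (cases "P s = White")
    case True
    have "(\<integral>\<^sup>+ \<omega>. ennreal (F (stopped P (Suc n) s \<omega>)) \<partial>coin_space p) =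
        (\<integral>\<^sup>+ b. \<integral>\<^sup>+ \<omega>. ennreal (F (stopped P (Suc n) s (b ## \<omega>))) \<partial>coin_space p
           \<partial>measure_pmf (bernoulli_pmf p))"
      using m unfolding coin_space_def
      by (rule prob_space.nn_integral_stream_space[OF prob_space_measure_pmf])
    also have "\<dots> = ennreal p * ennreal (stopped_mean p P F n (s + toss True))
        + ennreal (1 - p) * ennreal (stopped_mean p P F n (s + toss False))"
      using True p by (simp add: Suc.IH mult.commute)
    also have "\<dots> = ennreal (stopped_mean p P F (Suc n) s)"
      using True p stopped_mean_nonneg[OF p F]
      by (simp add: ennreal_mult[symmetric] ennreal_plus[symmetric] del: ennreal_plus)
    finally show ?thesis .
  next
    case False
    then show ?thesis using coin.emeasure_space_1[of p] by simp
  qed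
qed

lemma sets_stopped_colour: "{\<omega>. P (stopped P n s \<omega>) = col} \<in> sets (coin_space p)"
  using measurable_sets[OF measurable_stopped, of "{s. P s = col}" P n s p]
  by (simp add: vimage_def)

lemma emeasure_stopped_colour:
  assumes "0 \<le> p" "p \<le> 1"
  shows "emeasure (coin_space p) {\<omega>. P (stopped P n (0, 0) \<omega>) = col} = ennreal (colour_prob p P col n)"
proof -
  have "emeasure (coin_space p) {\<omega>. P (stopped P n (0, 0) \<omega>) = col} =
      (\<integral>\<^sup>+ \<omega>. ennreal (of_bool (P (stopped P n (0, 0) \<omega>) = col)) \<partial>coin_space p)"
    by (subst nn_integral_indicator[symmetric, OF sets_stopped_colour])
      (auto intro!: nn_integral_cong simp: indicator_def)
  also have "\<dots> = ennreal (colour_prob p P col n)"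
    by (rule nn_integral_stopped) (use assms in auto)
  finally show ?thesis .
qed

lemma colour_prob_nonneg: "0 \<le> p \<Longrightarrow> p \<le> 1 \<Longrightarrow> 0 \<le> colour_prob p P col n"
  by (rule stopped_mean_nonneg) auto

text \<open>Continuity from below: for a stopping colour the truncated events increase with
  \<open>n\<close>, whereas for \<open>White\<close> they decrease.\<close>

lemma prob_stops_at_lim:
  assumes p: "0 \<le> p" "p \<le> 1" and col: "col \<noteq> White"
  shows "colour_prob p P col \<longlonglongrightarrow> prob_stops_at p P col"
proof -
  let ?A = "\<lambda>n. {\<omega>. P (stopped P n (0, 0) \<omega>) = col}"
  have "incseq ?A"
    by (auto simp: incseq_def stopped_colour_iff[OF col])
  then have "(\<lambda>n. measure (coin_space p) (?A n)) \<longlonglongrightarrow> measure (coin_space p) (\<Union>n. ?A n)"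
    using sets_stopped_colour by (intro coin.finite_Lim_measure_incseq) auto
  moreover have "(\<Union>n. ?A n) = {\<omega> \<in> space (coin_space p). stops_at P col \<omega>}"
    by (auto simp: stops_at_iff[OF col])
  moreover have "measure (coin_space p) (?A n) = colour_prob p P col n" for n
    using emeasure_stopped_colour[OF p, of P n col] colour_prob_nonneg[OF p, of P col n]
    by (simp add: measure_def)
  ultimately show ?thesis by (simp add: prob_stops_at_def)
qed

text \<open>The tail-sum formula for the mean of an extended natural number; infinite values are
  included.\<close>

lemma expected_tosses_eq:
  assumes p: "0 \<le> p" "p \<le> 1"
  shows "expected_tosses p P = (\<Sum>n. ennreal (colour_prob p P White n))"
proof -
  have eq: "{\<omega> \<in> space (coin_space p). enat n < tosses P \<omega>} = {\<omega>. P (stopped P n (0, 0) \<omega>) = White}"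
    for n by (simp add: less_tosses_iff)
  have less: "{\<omega>. enat n < tosses P \<omega>} \<in> sets (coin_space p)" for n
    using sets_stopped_colour[of P n "(0, 0)" White p] by (simp add: less_tosses_iff)
  \<comment> \<open>Since \<open>enat\<close> is countable, measurability reduces to singletons, and
    these are built from tail events.\<close>
  have "tosses P -` {a} \<in> sets (coin_space p)" for a
  proof (cases a)
    case (enat m)
    have "x = enat m \<longleftrightarrow> \<not> enat m < x \<and> (\<forall>k<m. enat k < x)" for x
      by (cases x) (auto simp: not_less le_less)
    then have "tosses P -` {a} =
        (space (coin_space p) - {\<omega>. enat m < tosses P \<omega>}) \<inter>
        {\<omega> \<in> space (coin_space p). \<forall>k\<in>{..<m}. enat k < tosses P \<omega>}"
      by (auto simp: enat)
    also have "\<dots> \<in> sets (coin_space p)"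
      using less by (intro sets.Int sets.compl_sets sets.sets_Collect_finite_All) auto
    finally show ?thesis .
  next
    case infinity
    have "x = \<infinity> \<longleftrightarrow> (\<forall>n. enat n < x)" for x
      by (cases x) auto
    then have "tosses P -` {a} = (\<Inter>n. {\<omega>. enat n < tosses P \<omega>})"
      by (auto simp: infinity)
    then show ?thesis using less by auto
  qed
  then have meas: "tosses P \<in> measurable (coin_space p) (count_space UNIV)"
    by (subst measurable_count_space_eq2_countable) auto
  show ?thesis
    unfolding expected_tosses_def
    by (simp only: nn_integral_enat_function[OF meas] eq emeasure_stopped_colour[OF p])
qed

section \<open>The cell-wise inequalities\<close>

text \<open>The tangent line at \<open>B\<close> of the convex function \<open>(1 - 2 * b) * ln ((1 - b) / b)\<close>.\<close>

lemma log_odds_tangent_normalised: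
  fixes a b A B :: real
  assumes pos: "0 < a" "0 < b" "0 < A" "0 < B" and ab: "a + b = 1" "A + B = 1"
  shows "(A - B) * ln (A / B) + (2 * ln (A / B) + (A - B) / (A * B)) * (B - b)
         \<le> (a - b) * ln (a / b)"
proof -
  have a: "a = 1 - b" "A = 1 - B" using ab by auto
  have d: "a * B - b * A = B - b" by (simp add: a algebra_simps)
  \<comment> \<open>The quotient of the odds \<open>a / b\<close> and the reference odds
    \<open>A / B\<close>.\<close>
  define x where "x = (a * B) / (b * A)"
  have x: "0 < x" using pos by (simp add: x_def)
  have lnx: "ln x = ln (a / b) - ln (A / B)"
    using pos by (simp add: x_def ln_div ln_mult)
  \<comment> \<open>What remains of the claim after subtracting \<open>(a - b) * ln (A / B)\<close>.
    The sign of \<open>a - b\<close> decides which of \<open>1 - 1/x <= ln x\<close> and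
    \<open>ln x <= x - 1\<close> applies; in both cases the slack is \<open>(B - b)^2\<close> over a
    positive number.\<close>
  have key: "(A - B) / (A * B) * (B - b) \<le> (a - b) * ln x"
  proof (cases "b \<le> a")
    case True
    have "ln (inverse x) \<le> inverse x - 1" using x by (intro ln_le_minus_one) auto
    then have "1 - inverse x \<le> ln x" using x by (simp add: ln_inverse)
    moreover have "1 - inverse x = (B - b) / (a * B)"
      unfolding d[symmetric] using pos by (simp add: x_def field_simps)
    ultimately have "(a - b) * ((B - b) / (a * B)) \<le> (a - b) * ln x"
      using True by (intro mult_left_mono) auto
    moreover have "(a - b) * ((B - b) / (a * B)) - (A - B) / (A * B) * (B - b)
        = (B - b) * (a * B - b * A) / (a * A * B)"
      using pos by (simp add: field_simps)
    then have "(a - b) * ((B - b) / (a * B)) - (A - B) / (A * B) * (B - b) \<ge> 0"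
      unfolding d using pos by simp
    ultimately show ?thesis by linarith
  next
    case False
    have "ln x \<le> x - 1" using x by (rule ln_le_minus_one)
    moreover have "x - 1 = (B - b) / (b * A)"
      unfolding d[symmetric] using pos by (simp add: x_def field_simps)
    ultimately have "(a - b) * ((B - b) / (b * A)) \<le> (a - b) * ln x"
      using False by (intro mult_left_mono_neg) auto
    moreover have "(a - b) * ((B - b) / (b * A)) - (A - B) / (A * B) * (B - b)
        = (B - b) * (a * B - b * A) / (b * A * B)"
      using pos by (simp add: field_simps)
    then have "(a - b) * ((B - b) / (b * A)) - (A - B) / (A * B) * (B - b) \<ge> 0"
      unfolding d using pos by simp
    ultimately show ?thesis by linarith
  qed
  have "(A - B) * ln (A / B) + 2 * ln (A / B) * (B - b) = (a - b) * ln (A / B)"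
    by (simp add: a algebra_simps)
  then show ?thesis using key unfolding lnx by (simp add: algebra_simps)
qed

text \<open>The homogeneous form, for likelihoods in place of posteriors: normalise by
  \<open>a + b\<close> and \<open>A + B\<close>, then multiply back by \<open>a + b\<close>.
  \<open>K\<close> is minus the slope of the tangent.\<close>

lemma log_odds_tangent:
  fixes a b A B :: real
  assumes pos: "0 < a" "0 < b" "0 < A" "0 < B"
  defines "E \<equiv> B / (A + B)" and "K \<equiv> 2 * ln (A / B) + (A - B) * (A + B) / (A * B)"
  shows "(A - B) / (A + B) * ln (A / B) * (a + b) + K * (E * (a + b) - b) \<le> (a - b) * ln (a / b)"
proof -
  define u where "u = a + b"
  define U where "U = A + B"
  have u: "u > 0" "U > 0" using pos by (auto simp: u_def U_def)
  have e: "(a / u) / (b / u) = a / b" "(A / U) / (B / U) = A / B" using u by auto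
  have K: "K = 2 * ln (A / B) + (A / U - B / U) / (A / U * (B / U))"
    unfolding K_def U_def[symmetric] using u pos by (simp add: divide_simps)
  have "(A / U - B / U) * ln (A / B) + K * (B / U - b / u) \<le> (a / u - b / u) * ln (a / b)"
    using log_odds_tangent_normalised[of "a / u" "b / u" "A / U" "B / U"] u pos
    unfolding e K by (simp add: add_divide_distrib[symmetric] u_def U_def)
  then have "((A / U - B / U) * ln (A / B) + K * (B / U - b / u)) * u
      \<le> (a / u - b / u) * ln (a / b) * u"
    using u by (intro mult_right_mono) auto
  moreover have "(a / u - b / u) * ln (a / b) * u = (a - b) * ln (a / b)"
    using u by (simp add: field_simps)
  moreover have "((A / U - B / U) * ln (A / B) + K * (B / U - b / u)) * u
      = (A - B) / U * ln (A / B) * u + K * (B / U * u - b)"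
    using u by (simp add: field_simps)
  ultimately show ?thesis
    unfolding E_def u_def[symmetric] U_def[symmetric] by simp
qed

locale two_coins =
  fixes q r :: real
  assumes r_pos: "0 < r" and r_less_q: "r < q" and sum_1: "q + r = 1"
begin

lemma q_pos: "0 < q" using r_pos r_less_q by simp

definition llr :: real where "llr = ln (q / r)"

lemma llr_pos: "0 < llr"
  using r_pos r_less_q by (simp add: llr_def)

lemma ln_pow_ratio: "ln (q ^ c / r ^ c) = c * llr"
  using r_pos q_pos by (simp add: llr_def ln_div ln_realpow algebra_simps)

lemma ln_cell_ratio: "ln ((q ^ h * r ^ t) / (r ^ h * q ^ t)) = lead (h, t) * llr"
  using r_pos q_pos by (simp add: llr_def ln_div ln_mult ln_realpow lead_def algebra_simps)

text \<open>With equal priors, \<open>err c\<close> is the posterior error at a cell with lead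
  \<open>c\<close> in absolute value and prediction following the lead. There
  \<open>llr * gain c\<close> is the value of the convex function and \<open>price c\<close> is
  minus its slope.\<close>

definition err :: "nat \<Rightarrow> real" where "err c = r ^ c / (q ^ c + r ^ c)"
definition gain :: "nat \<Rightarrow> real" where "gain c = c * ((q ^ c - r ^ c) / (q ^ c + r ^ c))"
definition price :: "nat \<Rightarrow> real" where
  "price c = 2 * (c * llr) + (q ^ c - r ^ c) * (q ^ c + r ^ c) / (q ^ c * r ^ c)"

lemma price_pos: "0 < c \<Longrightarrow> 0 < price c"
  unfolding price_def using r_pos q_pos llr_pos r_less_q power_strict_mono[of r q c]
  by (intro add_pos_pos divide_pos_pos mult_pos_pos) (auto intro: add_pos_pos)

text \<open>The subtracted likelihood is that of an error: \<open>b\<close> for a blue cell,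
  \<open>a\<close> for a red one. The second bound is the first with \<open>a\<close> and
  \<open>b\<close> exchanged. The tangent bounds the function on all of (0,1), so predictions
  against the lead are covered.\<close>

lemma cell_lower:
  fixes h t c :: nat
  defines "a \<equiv> q ^ h * r ^ t" and "b \<equiv> r ^ h * q ^ t"
  shows "llr * gain c * (a + b) + price c * (err c * (a + b) - b) \<le> (a - b) * (lead (h, t) * llr)"
    and "llr * gain c * (a + b) + price c * (err c * (a + b) - a) \<le> (a - b) * (lead (h, t) * llr)"
proof -
  have pos: "0 < a" "0 < b" "0 < q ^ c" "0 < r ^ c"
    using r_pos q_pos by (auto simp: a_def b_def)
  have 1: "ln (a / b) = lead (h, t) * llr"
    unfolding a_def b_def by (rule ln_cell_ratio)
  then have 2: "ln (b / a) = - (lead (h, t) * llr)"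
    using pos by (simp add: ln_div)
  show "llr * gain c * (a + b) + price c * (err c * (a + b) - b) \<le> (a - b) * (lead (h, t) * llr)"
    using log_odds_tangent[OF pos] unfolding 1 ln_pow_ratio
    by (simp add: gain_def price_def err_def algebra_simps)
  show "llr * gain c * (a + b) + price c * (err c * (a + b) - a) \<le> (a - b) * (lead (h, t) * llr)"
    using log_odds_tangent[OF pos(2,1,3,4)] unfolding 2 ln_pow_ratio
    by (simp add: gain_def price_def err_def algebra_simps)
qed

text \<open>After cancelling \<open>(q * r) ^ t\<close>, both the lead \<open>d\<close> and the
  posterior difference \<open>(q^d - r^d) / (q^d + r^d)\<close> increase with \<open>d\<close>, so
  the extreme case is \<open>d = c\<close>.\<close>

lemma cell_upper_aux:
  assumes "t \<le> h" "h \<le> t + c"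
  shows "(q ^ h * r ^ t - r ^ h * q ^ t) * lead (h, t)
         \<le> gain c * (q ^ h * r ^ t + r ^ h * q ^ t)"
proof -
  obtain d where d: "h = t + d" "d \<le> c"
    using assms by (metis le_add_diff_inverse nat_add_left_cancel_le)
  define z where "z = (q * r) ^ t"
  have z: "0 < z" using q_pos r_pos by (simp add: z_def)
  have eq: "q ^ h * r ^ t = z * q ^ d" "r ^ h * q ^ t = z * r ^ d"
    by (simp_all add: z_def d power_add power_mult_distrib)
  have ge: "r ^ d \<le> q ^ d" for d using r_pos r_less_q by (intro power_mono) auto
  have pos: "0 < q ^ n + r ^ n" for n using q_pos r_pos by (intro add_pos_pos) auto
  have "q ^ d * r ^ c \<le> q ^ c * r ^ d"
  proof -
    obtain k where "c = d + k" using d(2) le_Suc_ex by blast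
    then show ?thesis using ge[of k] q_pos r_pos by (simp add: power_add)
  qed
  then have "(q ^ d - r ^ d) * (q ^ c + r ^ c) \<le> (q ^ c - r ^ c) * (q ^ d + r ^ d)"
    by (simp add: algebra_simps)
  then have "q ^ d - r ^ d \<le> (q ^ c - r ^ c) / (q ^ c + r ^ c) * (q ^ d + r ^ d)"
    using pos[of c] by (simp add: pos_le_divide_eq)
  then have "real d * (q ^ d - r ^ d) \<le> gain c * (q ^ d + r ^ d)"
    unfolding gain_def mult.assoc using d(2) ge[of d] by (intro mult_mono) auto
  then have "z * (real d * (q ^ d - r ^ d)) \<le> z * (gain c * (q ^ d + r ^ d))"
    using z by (intro mult_left_mono) auto
  then show ?thesis unfolding eq by (simp add: lead_def d(1) algebra_simps)
qed

lemma cell_upper: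
  assumes "\<bar>lead (h, t)\<bar> \<le> c"
  shows "(q ^ h * r ^ t - r ^ h * q ^ t) * lead (h, t)
         \<le> gain c * (q ^ h * r ^ t + r ^ h * q ^ t)"
proof (cases "t \<le> h")
  case True
  then show ?thesis using assms by (intro cell_upper_aux) (auto simp: lead_def)
next
  case False
  then have "(q ^ t * r ^ h - r ^ t * q ^ h) * lead (t, h)
         \<le> gain c * (q ^ t * r ^ h + r ^ t * q ^ h)"
    using assms by (intro cell_upper_aux) (auto simp: lead_def)
  then show ?thesis by (simp add: lead_def algebra_simps)
qed

section \<open>Bounds for truncated policies\<close>

abbreviation mean_time :: "policy \<Rightarrow> nat \<Rightarrow> real" where
  "mean_time P n \<equiv> (\<Sum>k<n. colour_prob q P White k) + (\<Sum>k<n. colour_prob r P White k)"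

text \<open>The drifts under the two hypotheses are opposite, so subtracting the mean leads adds the
  mean times.\<close>

lemma mean_lead_diff:
  "stopped_mean q P lead n (0, 0) - stopped_mean r P lead n (0, 0) = (q - r) * mean_time P n"
proof -
  have eq: "2 * q - 1 = q - r" "2 * r - 1 = - (q - r)" using sum_1 by auto
  show ?thesis
    unfolding stopped_mean_lead eq by (simp add: lead_def algebra_simps)
qed

text \<open>\<open>cell_lower\<close> summed over the final cells. A run cut off at a white cell is
  charged as an error under both hypotheses.\<close>

lemma mean_time_lower:
  "2 * (llr * gain c) + price c * (2 * err c
     - (colour_prob q P Red n + colour_prob q P White n)
     - (colour_prob r P Blue n + colour_prob r P White n))
   \<le> llr * ((q - r) * mean_time P n)"
proof -
  let ?I = "\<lambda>col s. of_bool (P s = col) :: real"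
  let ?M = "llr * gain c + price c * err c"
  let ?F = "\<lambda>s. llr * lead s - ?M + price c * (?I Red s + ?I White s)"
  let ?G = "\<lambda>s. - (llr * lead s) - ?M + price c * (?I Blue s + ?I White s)"
  have price: "0 \<le> price c"
    unfolding price_def using r_pos q_pos llr_pos r_less_q power_mono[of r q c]
    by (intro add_nonneg_nonneg divide_nonneg_nonneg mult_nonneg_nonneg) auto
  have "0 \<le> stopped_mean q P ?F n (0, 0) + stopped_mean r P ?G n (0, 0)"
  proof (rule mixture_nonneg_0[OF sum_1, where S = UNIV])
    fix h t :: nat
    \<comment> \<open>The surplus at a white cell, where both likelihoods are charged but
      \<open>cell_lower\<close> needs only one.\<close>
    have "0 \<le> price c * (r ^ h * q ^ t)"
      using price q_pos r_pos by simp
    then show "0 \<le> q ^ h * r ^ t * ?F (h, t) + r ^ h * q ^ t * ?G (h, t)"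
      using cell_lower[of c h t] by (cases "P (h, t)") (simp_all add: algebra_simps)
  qed auto
  moreover have "stopped_mean q P ?F n (0, 0) = llr * stopped_mean q P lead n (0, 0) - ?M
     + price c * (colour_prob q P Red n + colour_prob q P White n)"
    by (simp only: stopped_mean_linear)
  moreover have "stopped_mean r P ?G n (0, 0) = - (llr * stopped_mean r P lead n (0, 0)) - ?M
     + price c * (colour_prob r P Blue n + colour_prob r P White n)"
    by (simp only: stopped_mean_linear)
  ultimately show ?thesis unfolding mean_lead_diff[symmetric]
    by (simp add: algebra_simps)
qed

section \<open>Upper bounds for the linear policy\<close>

definition strip :: "nat \<Rightarrow> (nat \<times> nat) set" where
  "strip c = {s. \<bar>lead s\<bar> \<le> c}"

lemma linear_policy_strip:
  assumes "s \<in> strip c" "linear_policy c s = White"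
  shows "s + toss b \<in> strip c"
proof -
  obtain h t where s: "s = (h, t)" by fastforce
  have "\<bar>int h - int t\<bar> \<noteq> int c"
    using assms(2) by (auto simp: s linear_policy_def split: if_splits)
  moreover have "\<bar>int h - int t\<bar> \<le> int c"
    using assms(1) by (auto simp: s strip_def lead_def)
  \<comment> \<open>By integrality, a white cell of the strip is at least one toss away from leaving
    it.\<close>
  ultimately have "\<bar>int h - int t\<bar> + 1 \<le> int c" by linarith
  then have "real_of_int (\<bar>int h - int t\<bar> + 1) \<le> real_of_int (int c)" by (rule of_int_le_iff[THEN iffD2])
  then have "\<bar>real h - real t\<bar> + 1 \<le> c" by simp
  then show ?thesis by (cases b) (auto simp: s strip_def lead_def toss_def)
qed

lemma zero_in_strip: "(0, 0) \<in> strip c"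
  by (simp add: strip_def lead_def)

text \<open>\<open>cell_upper\<close> holds at every cell of the strip, white or not, so the
  truncation costs nothing.\<close>

lemma mean_time_linear_upper: "(q - r) * mean_time (linear_policy c) n \<le> 2 * gain c"
proof -
  have "0 \<le> stopped_mean q (linear_policy c) (\<lambda>s. gain c - lead s) n (0, 0)
          + stopped_mean r (linear_policy c) (\<lambda>s. gain c + lead s) n (0, 0)"
  proof (rule mixture_nonneg_0[OF sum_1, where S = "strip c"])
    fix h t assume "(h, t) \<in> strip c"
    then show "0 \<le> q ^ h * r ^ t * (gain c - lead (h, t)) + r ^ h * q ^ t * (gain c + lead (h, t))"
      using cell_upper[of h t c] by (simp add: strip_def algebra_simps)
  qed (auto intro: linear_policy_strip zero_in_strip)
  then show ?thesis
    unfolding stopped_mean_linear mean_lead_diff[symmetric] by simp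
qed

text \<open>At blue and red cells the lead is \<open>c\<close> in absolute value and the posterior
  error equals \<open>err c\<close>, so the weighted sum vanishes. All other cells, also those
  outside the strip, are white and contribute nonnegatively.\<close>

lemma error_linear_upper:
  "colour_prob q (linear_policy c) Red n + colour_prob r (linear_policy c) Blue n \<le> 2 * err c"
proof -
  let ?P = "linear_policy c"
  have "0 \<le> stopped_mean q ?P (\<lambda>s. err c - of_bool (?P s = Red)) n (0, 0)
          + stopped_mean r ?P (\<lambda>s. err c - of_bool (?P s = Blue)) n (0, 0)"
  proof (rule mixture_nonneg_0[OF sum_1, where S = UNIV])
    fix h t :: nat
    have pos: "0 < q ^ c" "0 < r ^ c" "0 < q ^ c + r ^ c" "0 < q ^ h * r ^ t" "0 < r ^ h * q ^ t"
      using q_pos r_pos by (auto intro: add_pos_pos)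
    have err: "0 \<le> err c" using pos by (simp add: err_def)
    have eq: "err c * (q ^ c + r ^ c) = r ^ c"
      using pos by (simp add: err_def)
    show "0 \<le> q ^ h * r ^ t * (err c - of_bool (?P (h, t) = Red))
             + r ^ h * q ^ t * (err c - of_bool (?P (h, t) = Blue))"
    proof (cases "?P (h, t)")
      case White
      then show ?thesis using err pos by simp
    next
      case Blue
      then have "h = t + c" by (auto simp: linear_policy_def split: if_splits)
      then have "q ^ h * r ^ t * err c + r ^ h * q ^ t * (err c - 1)
          = (q * r) ^ t * (err c * (q ^ c + r ^ c) - r ^ c)"
        by (simp add: power_add power_mult_distrib algebra_simps)
      then show ?thesis using Blue by (simp add: eq)
    next
      case Red
      then have "t = h + c" by (auto simp: linear_policy_def split: if_splits)
      then have "q ^ h * r ^ t * (err c - 1) + r ^ h * q ^ t * err c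
          = (q * r) ^ h * (err c * (q ^ c + r ^ c) - r ^ c)"
        by (simp add: power_add power_mult_distrib algebra_simps)
      then show ?thesis using Red by (simp add: eq)
    qed
  qed auto
  then show ?thesis unfolding stopped_mean_linear by simp
qed

section \<open>Removing the truncation\<close>

lemma prob_bounds: "0 \<le> q" "q \<le> 1" "0 \<le> r" "r \<le> 1"
  using q_pos r_pos sum_1 by auto

lemma error_linear_le:
  "prob_stops_at q (linear_policy c) Red + prob_stops_at r (linear_policy c) Blue \<le> 2 * err c"
  by (rule LIMSEQ_le_const2[OF tendsto_add[OF prob_stops_at_lim prob_stops_at_lim]])
    (use prob_bounds error_linear_upper in auto)

text \<open>The partial sums of the tail series are bounded uniformly, which also shows that the
  linear policy has finite expected times.\<close>

lemma expected_tosses_linear_le: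
  "expected_tosses q (linear_policy c) + expected_tosses r (linear_policy c)
     \<le> ennreal (2 * gain c / (q - r))"
proof -
  let ?v = "\<lambda>p. colour_prob p (linear_policy c) White"
  have nonneg: "0 \<le> ?v q n" "0 \<le> ?v r n" for n
    using prob_bounds by (auto intro: colour_prob_nonneg)
  have "(\<Sum>n. ennreal (?v q n)) + (\<Sum>n. ennreal (?v r n)) = (\<Sum>n. ennreal (?v q n + ?v r n))"
    using nonneg by (subst suminf_add) (auto simp: ennreal_plus)
  also have "\<dots> \<le> ennreal (2 * gain c / (q - r))"
  proof (rule suminf_le_const)
    fix n
    have "(\<Sum>k<n. ennreal (?v q k + ?v r k)) = ennreal (mean_time (linear_policy c) n)"
      using nonneg by (subst sum_ennreal) (auto simp: sum.distrib)
    also have "\<dots> \<le> ennreal (2 * gain c / (q - r))"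
      using mean_time_linear_upper[of c n] r_less_q
      by (intro ennreal_leI) (simp add: pos_le_divide_eq mult.commute)
    finally show "(\<Sum>k<n. ennreal (?v q k + ?v r k)) \<le> ennreal (2 * gain c / (q - r))" .
  qed auto
  finally show ?thesis using prob_bounds by (simp add: expected_tosses_eq)
qed

lemma expected_tosses_finite_sums:
  assumes p: "0 \<le> p" "p \<le> 1" and "expected_tosses p P < \<infinity>"
  shows "colour_prob p P White sums enn2real (expected_tosses p P)"
proof -
  let ?v = "colour_prob p P White"
  have nonneg: "\<And>n. 0 \<le> ?v n" using p by (rule colour_prob_nonneg)
  have "(\<Sum>n. ennreal (?v n)) \<noteq> \<top>" using assms by (simp add: expected_tosses_eq)
  then have s: "summable ?v" by (rule summable_suminf_not_top[OF nonneg])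
  then have "expected_tosses p P = ennreal (suminf ?v)"
    using p by (simp add: expected_tosses_eq suminf_ennreal2[OF nonneg s])
  then show ?thesis using s suminf_nonneg[OF s nonneg] by (simp add: summable_sums)
qed

lemma expected_tosses_lower:
  assumes "expected_tosses q P < \<infinity>" "expected_tosses r P < \<infinity>"
  shows "2 * (llr * gain c) + price c * (2 * err c - prob_stops_at q P Red - prob_stops_at r P Blue)
    \<le> llr * ((q - r) * (enn2real (expected_tosses q P) + enn2real (expected_tosses r P)))"
proof -
  note b = prob_bounds
  note sq = expected_tosses_finite_sums[OF b(1,2) assms(1)]
  note sr = expected_tosses_finite_sums[OF b(3,4) assms(2)]
  \<comment> \<open>The white probabilities are the terms of a convergent series, so the charge for
    truncated runs tends to 0.\<close>
  have "(\<lambda>n. 2 * (llr * gain c) + price c * (2 * err c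
     - (colour_prob q P Red n + colour_prob q P White n)
     - (colour_prob r P Blue n + colour_prob r P White n)))
    \<longlonglongrightarrow> 2 * (llr * gain c) + price c * (2 * err c
     - (prob_stops_at q P Red + 0) - (prob_stops_at r P Blue + 0))"
    by (intro tendsto_intros prob_stops_at_lim b summable_LIMSEQ_zero sums_summable[OF sq]
        sums_summable[OF sr]) auto
  moreover have "(\<lambda>n. llr * ((q - r) * mean_time P n)) \<longlonglongrightarrow>
      llr * ((q - r) * (enn2real (expected_tosses q P) + enn2real (expected_tosses r P)))"
    by (intro tendsto_intros sq[unfolded sums_def] sr[unfolded sums_def])
  ultimately have "2 * (llr * gain c) + price c * (2 * err c
     - (prob_stops_at q P Red + 0) - (prob_stops_at r P Blue + 0))
    \<le> llr * ((q - r) * (enn2real (expected_tosses q P) + enn2real (expected_tosses r P)))"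
    by (rule LIMSEQ_le) (use mean_time_lower in blast)
  then show ?thesis by simp
qed

text \<open>A strictly smaller error gives a strictly larger time because \<open>price c\<close> is
  positive for positive \<open>c\<close>.\<close>

lemma linear_optimal_pos:
  assumes fin: "expected_tosses q P < \<infinity>" "expected_tosses r P < \<infinity>" and c: "0 < c"
    and less: "prob_stops_at q P Red + prob_stops_at r P Blue < 2 * err c"
  shows "ennreal (2 * gain c / (q - r)) < expected_tosses q P + expected_tosses r P"
proof -
  let ?H = "enn2real (expected_tosses q P) + enn2real (expected_tosses r P)"
  have "0 < price c * (2 * err c - prob_stops_at q P Red - prob_stops_at r P Blue)"
    using less price_pos[OF c] by simp
  then have "llr * (2 * gain c) < llr * ((q - r) * ?H)"
    using expected_tosses_lower[OF fin, of c] by simp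
  then have "2 * gain c < (q - r) * ?H" using llr_pos by simp
  then have *: "2 * gain c / (q - r) < ?H"
    using r_less_q by (simp add: pos_divide_less_eq mult.commute)
  have "0 \<le> 2 * gain c / (q - r)"
    using r_less_q r_pos q_pos power_mono[of r q c]
    by (auto simp: gain_def intro!: divide_nonneg_nonneg mult_nonneg_nonneg add_nonneg_nonneg)
  then have "ennreal (2 * gain c / (q - r)) < ennreal ?H"
    using * by (subst ennreal_less_iff)
  also have "ennreal ?H = expected_tosses q P + expected_tosses r P"
    using fin by (simp add: ennreal_plus ennreal_enn2real)
  finally show ?thesis .
qed

text \<open>For \<open>c = 0\<close> the tangent is horizontal and \<open>price 0 = 0\<close>, hence the separate argument.\<close>

lemma linear_optimal_zero:
  assumes "prob_stops_at q P Red + prob_stops_at r P Blue < 2 * err 0"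
  shows "ennreal (2 * gain 0 / (q - r)) < expected_tosses q P + expected_tosses r P"
proof (cases "P (0, 0) = White")
  case True
  \<comment> \<open>A white origin forces at least one toss, the term \<open>n = 0\<close> of the
    tail series, while \<open>gain 0 = 0\<close>.\<close>
  define f where "f n = ennreal (colour_prob q P White n)" for n
  have "sum f {0} \<le> suminf f" by (rule sum_le_suminf) auto
  then have "1 \<le> suminf f" using True by (simp add: f_def)
  then have "1 \<le> expected_tosses q P"
    using prob_bounds by (simp add: expected_tosses_eq f_def[abs_def])
  then have "0 < expected_tosses q P + expected_tosses r P"
    by (metis add_pos_nonneg less_le_trans zero_le zero_less_one)
  then show ?thesis by (simp add: gain_def)
next
  case False
  \<comment> \<open>A policy stopping at the origin errs surely under exactly one hypothesis, so its
    error sum is \<open>1 = 2 * err 0\<close>, against the assumption.\<close>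
  have "stopped_mean p P F n (0, 0) = F (0, 0)" for p F n
    using False by (cases n) auto
  then have "prob_stops_at p P col = of_bool (P (0, 0) = col)"
    if "0 \<le> p" "p \<le> 1" "col \<noteq> White" for p col
    using LIMSEQ_unique[OF prob_stops_at_lim[OF that, of P]] by simp
  then have "prob_stops_at q P Red + prob_stops_at r P Blue = 1"
    using prob_bounds False by (cases "P (0, 0)") auto
  then show ?thesis using assms by (simp add: err_def)
qed

text \<open>The values \<open>2 * err c\<close> and \<open>2 * gain c / (q - r)\<close> bound the
  linear policy from above, and the lower bound for \<open>P\<close> is compared with them.\<close>

lemma linear_optimal:
  assumes fin: "expected_tosses q P < \<infinity>" "expected_tosses r P < \<infinity>"
    and less: "prob_stops_at q P Red + prob_stops_at r P Blue <
      prob_stops_at q (linear_policy c) Red + prob_stops_at r (linear_policy c) Blue"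
  shows "expected_tosses q (linear_policy c) + expected_tosses r (linear_policy c)
    < expected_tosses q P + expected_tosses r P"
proof -
  have "prob_stops_at q P Red + prob_stops_at r P Blue < 2 * err c"
    using less error_linear_le by (rule less_le_trans)
  then have "ennreal (2 * gain c / (q - r)) < expected_tosses q P + expected_tosses r P"
    using linear_optimal_pos[OF fin] linear_optimal_zero by (cases "c = 0") auto
  with expected_tosses_linear_le show ?thesis by (rule le_less_trans)
qed

end

theorem theorem1:
  fixes \<epsilon> :: real and c :: nat and P :: policy
  assumes "0 < \<epsilon>" and "\<epsilon> < 1/2"
    and "admissible \<epsilon> P"
    and "P \<noteq> linear_policy c"
    and "delta_plus \<epsilon> P + delta_minus \<epsilon> P
           < delta_plus \<epsilon> (linear_policy c) + delta_minus \<epsilon> (linear_policy c)"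
  shows "H_plus \<epsilon> P + H_minus \<epsilon> P
           > H_plus \<epsilon> (linear_policy c) + H_minus \<epsilon> (linear_policy c)"
proof -
  interpret two_coins "1/2 + \<epsilon>" "1/2 - \<epsilon>"
    using assms(1,2) by unfold_locales auto
  show ?thesis
    using linear_optimal assms(3,5)
    by (simp add: admissible_def H_plus_def H_minus_def delta_plus_def delta_minus_def)
qed

end
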